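(* Let $\mathcal M:\ \mathbf z=\mathbf z(x,y)$, $(x,y)\in\mathcal D$, be a minimal strongly regular time-like surface in $\mathbb R^3_1$ (in the sense of the context) whose parametric net is principal, with normal curvature function $\nu=\nu_1>0$. Then there exist locally (i.e. in a neighborhood of every point of $\mathcal D$) principal parameters $(\bar x,\bar y)$ such that $$\mathbf z_{\bar x}^2=\mathbf z_{\bar y}^2=\frac1\nu .$$
   Context: $\mathbb R^3_1$ is $\mathbb R^3$ with the inner product $\langle a,b\rangle=a_1b_1+a_2b_2-a_3b_3$, and $a^2:=\langle a,a\rangle$. Everything is smooth. Subscripts denote partial derivatives. A time-like surface (the name refers to the causal character of its normal) is an immersion $\mathbf z:\mathcal D\to\mathbb R^3_1$ of a domain $\mathcal D\subset\mathbb R^2$ whose induced metric is positive definite, so its unit normal $l$ satisfies $l^2=-1$. Put $E=\mathbf z_x^2$, $F=\langle\mathbf z_x,\mathbf z_y\rangle$, $G=\mathbf z_y^2$, $e=\langle\mathbf z_{xx},l\rangle$, $f=\langle\mathbf z_{xy},l\rangle$, $g=\langle\mathbf z_{yy},l\rangle$. Surfaces have no umbilical points; parameters are principal (the parametric net is principal) if $F=f=0$. In principal parameters, put $$\nu_1=\frac eE,\quad \nu_2=\frac gG,\quad \gamma_1=-\frac{E_y}{2E\sqrt G},\quad \gamma_2=\frac{G_x}{2G\sqrt E}$$ (principal curvatures and principal geodesic curvatures). The unit normal $l$ is chosen so that $\nu_1-\nu_2>0$ (and $\mathbb R^3_1$ is oriented so that $(\mathbf z_x,\mathbf z_y,l)$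 is positively oriented). The surface is strongly regular if $\gamma_1\gamma_2\neq0$ on $\mathcal D$, and minimal if $\nu_1+\nu_2=0$; then $\nu:=\nu_1>0$ is called the normal curvature function. *)

theory Defs
  imports "HOL-Analysis.Analysis"
begin

section \<open>Smooth maps and changes of parameters\<close>

text \<open>
  \<open>Ck_on k S f\<close> is meant for open \<open>S\<close> in a Euclidean space, where it says that \<open>f\<close> is
  \<open>k\<close> times continuously differentiable on \<open>S\<close>: the maps
  \<open>\<lambda>x. frechet_derivative f (at x) v\<close> are the directional derivatives of \<open>f\<close>.
\<close>

primrec Ck_on ::
  "nat \<Rightarrow> 'a::euclidean_space set \<Rightarrow> ('a \<Rightarrow> 'b::euclidean_space) \<Rightarrow> bool" where
  "Ck_on 0 S f \<longleftrightarrow> continuous_on S f"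
| "Ck_on (Suc k) S f \<longleftrightarrow>
     (\<forall>x\<in>S. f differentiable (at x)) \<and>
     (\<forall>v. Ck_on k S (\<lambda>x. frechet_derivative f (at x) v))"

definition smooth_on ::
  "'a::euclidean_space set \<Rightarrow> ('a \<Rightarrow> 'b::euclidean_space) \<Rightarrow> bool" where
  "smooth_on S f \<longleftrightarrow> (\<forall>k. Ck_on k S f)"

definition diffeomorphism ::
  "'a::euclidean_space set \<Rightarrow> 'b::euclidean_space set \<Rightarrow> ('a \<Rightarrow> 'b) \<Rightarrow> ('b \<Rightarrow> 'a) \<Rightarrow> bool" where
  "diffeomorphism U V \<phi> \<psi> \<longleftrightarrow>
     open U \<and> open V \<and> homeomorphism U V \<phi> \<psi> \<and> smooth_on U \<phi> \<and> smooth_on V \<psi>"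

definition partial_x :: "(real \<times> real \<Rightarrow> 'a::real_normed_vector) \<Rightarrow> real \<times> real \<Rightarrow> 'a" where
  "partial_x h p = vector_derivative (\<lambda>t. h (t, snd p)) (at (fst p))"

definition partial_y :: "(real \<times> real \<Rightarrow> 'a::real_normed_vector) \<Rightarrow> real \<times> real \<Rightarrow> 'a" where
  "partial_y h p = vector_derivative (\<lambda>t. h (fst p, t)) (at (snd p))"


section \<open>Parametrized surfaces in Minkowski space\<close>

definition lorentz :: "real^3 \<Rightarrow> real^3 \<Rightarrow> real" where
  "lorentz a b = a$1 * b$1 + a$2 * b$2 - a$3 * b$3"

type_synonym param = "real \<times> real \<Rightarrow> real^3"

definition coeff_E :: "param \<Rightarrow> real \<times> real \<Rightarrow> real" where
  "coeff_E z p = lorentz (partial_x z p) (partial_x z p)"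

definition coeff_F :: "param \<Rightarrow> real \<times> real \<Rightarrow> real" where
  "coeff_F z p = lorentz (partial_x z p) (partial_y z p)"

definition coeff_G :: "param \<Rightarrow> real \<times> real \<Rightarrow> real" where
  "coeff_G z p = lorentz (partial_y z p) (partial_y z p)"

definition coeff_e :: "param \<Rightarrow> param \<Rightarrow> real \<times> real \<Rightarrow> real" where
  "coeff_e z l p = lorentz (partial_x (partial_x z) p) (l p)"

definition coeff_f :: "param \<Rightarrow> param \<Rightarrow> real \<times> real \<Rightarrow> real" where
  "coeff_f z l p = lorentz (partial_y (partial_x z) p) (l p)"

definition coeff_g :: "param \<Rightarrow> param \<Rightarrow> real \<times> real \<Rightarrow> real" where
  "coeff_g z l p = lorentz (partial_y (partial_y z) p) (l p)"

text \<open>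
  ``Time-like'' refers to the normal: the tangent planes are space-like.
\<close>

definition timelike_surface :: "(real \<times> real) set \<Rightarrow> param \<Rightarrow> bool" where
  "timelike_surface D z \<longleftrightarrow>
     open D \<and> connected D \<and> smooth_on D z \<and>
     (\<forall>p\<in>D. inj (frechet_derivative z (at p))) \<and>
     (\<forall>p\<in>D. \<forall>a b. (a, b) \<noteq> (0, 0) \<longrightarrow>
        coeff_E z p * a\<^sup>2 + 2 * coeff_F z p * a * b + coeff_G z p * b\<^sup>2 > 0)"

definition unit_normal :: "(real \<times> real) set \<Rightarrow> param \<Rightarrow> param \<Rightarrow> bool" where
  "unit_normal D z l \<longleftrightarrow>
     smooth_on D l \<and>
     (\<forall>p\<in>D. lorentz (l p) (partial_x z p) = 0 \<and> lorentz (l p) (partial_y z p) = 0 \<and>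
        lorentz (l p) (l p) = -1)"

definition principal_net :: "(real \<times> real) set \<Rightarrow> param \<Rightarrow> param \<Rightarrow> bool" where
  "principal_net D z l \<longleftrightarrow> (\<forall>p\<in>D. coeff_F z p = 0 \<and> coeff_f z l p = 0)"

text \<open>
  The following four functions have their geometric meaning (principal curvatures and
  principal geodesic curvatures) in principal parameters only.
\<close>

definition nu1 :: "param \<Rightarrow> param \<Rightarrow> real \<times> real \<Rightarrow> real" where
  "nu1 z l p = coeff_e z l p / coeff_E z p"

definition nu2 :: "param \<Rightarrow> param \<Rightarrow> real \<times> real \<Rightarrow> real" where
  "nu2 z l p = coeff_g z l p / coeff_G z p"

definition gamma1 :: "param \<Rightarrow> real \<times> real \<Rightarrow> real" where
  "gamma1 z p = - partial_y (coeff_E z) p / (2 * coeff_E z p * sqrt (coeff_G z p))"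

definition gamma2 :: "param \<Rightarrow> real \<times> real \<Rightarrow> real" where
  "gamma2 z p = partial_x (coeff_G z) p / (2 * coeff_G z p * sqrt (coeff_E z p))"

text \<open>
  A time-like surface in principal parameters with the standing conventions.  The sign of \<open>l\<close>
  is fixed by \<open>nu1 > nu2\<close>, which also excludes umbilical points.  The orientation of the
  ambient space is the sign \<open>\<sigma>\<close> (\<open>1\<close> for the standard orientation, \<open>-1\<close> for the opposite one);
  the frame \<open>(z\<^sub>x, z\<^sub>y, l)\<close> is positive for it.
\<close>

definition principal_timelike_surface ::
  "real \<Rightarrow> (real \<times> real) set \<Rightarrow> param \<Rightarrow> param \<Rightarrow> bool" where
  "principal_timelike_surface \<sigma> D z l \<longleftrightarrow>
     \<sigma> \<in> {1, -1} \<and> timelike_surface D z \<and> unit_normal D z l \<and> principal_net D z l \<and>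
     (\<forall>p\<in>D. nu1 z l p - nu2 z l p > 0) \<and>
     (\<forall>p\<in>D. \<sigma> * det (vector [partial_x z p, partial_y z p, l p] :: real^3^3) > 0)"

definition strongly_regular :: "(real \<times> real) set \<Rightarrow> param \<Rightarrow> bool" where
  "strongly_regular D z \<longleftrightarrow> (\<forall>p\<in>D. gamma1 z p * gamma2 z p \<noteq> 0)"

definition minimal_surface :: "(real \<times> real) set \<Rightarrow> param \<Rightarrow> param \<Rightarrow> bool" where
  "minimal_surface D z l \<longleftrightarrow> (\<forall>p\<in>D. nu1 z l p + nu2 z l p = 0)"

end

theory Submission imports Defs begin

text \<open>
  For a minimal surface the Codazzi equations say that \<open>e\<close> depends on \<open>x\<close> only and \<open>g\<close> on \<open>y\<close>
  only, in a rectangle of principal parameters. Since \<open>e = \<nu>E > 0\<close> and \<open>g = -\<nu>G < 0\<close>, the functions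
  \<open>\<integral> sqrt e dx\<close> and \<open>\<integral> sqrt (-g) dy\<close> can serve as new parameters; they keep the parametric net,
  hence are principal, and they turn the metric coefficients into \<open>E/e = G/(-g) = 1/\<nu>\<close>.
\<close>

section \<open>Calculus of \<open>C\<^sup>k\<close> maps\<close>

text \<open>Why \<open>e\<close> loses its dependence on \<open>y\<close>: in a principal net,
  \<open>e_y = (nu1 + nu2) <z_x, z_xy>\<close>, obtained by differentiating \<open>F = 0\<close> and
  \<open>f = 0\<close> in \<open>x\<close> and exchanging third derivatives; minimality kills the
  factor. Symmetrically for \<open>g_x\<close>. Why the new net is still principal and has the right
  metric: in a substitution \<open>x = X(u)\<close>, \<open>y = Y(v)\<close> the vectors
  \<open>z_x\<close> and \<open>z_y\<close> are only rescaled, \<open>E\<close> and \<open>e\<close>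
  pick up the same factor \<open>X'^2\<close>, and \<open>G\<close> and \<open>g\<close> the factor
  \<open>Y'^2\<close>. So \<open>nu1\<close> is the same function on the surface, and
  \<open>X'^2 = 1/e\<close>, \<open>Y'^2 = -1/g\<close> give the claim. Positive speeds keep the
  orientation of the frame. Two points shape the formal proof. A vanishing partial derivative gives
  constancy only along segments inside the domain, so everything happens in a box around the given
  point. And the new surface must satisfy the full definition again, including smoothness in the
  recursive sense of \<open>Ck_on\<close>; this calls for a calculus of \<open>C^k\<close> maps,
  including the inverse of an antiderivative.\<close>

lemma Ck_on_cong:
  assumes "open S" and "\<And>x. x \<in> S \<Longrightarrow> f x = g x" and "Ck_on k S f"
  shows "Ck_on k S g"
  using assms
proof (induction k arbitrary: f g)
  case 0
  then show ?case by (simp cong: continuous_on_cong)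
next
  case (Suc k)
  have der: "(g has_derivative frechet_derivative f (at x)) (at x)" if "x \<in> S" for x
  proof (rule has_derivative_transform_within_open[OF _ \<open>open S\<close> that Suc.prems(2)])
    show "(f has_derivative frechet_derivative f (at x)) (at x)"
      using Suc.prems(3) that frechet_derivative_works by auto
  qed
  then have eq: "frechet_derivative f (at x) = frechet_derivative g (at x)" if "x \<in> S" for x
    using frechet_derivative_at that by blast
  have "Ck_on k S (\<lambda>x. frechet_derivative g (at x) v)" for v
    by (rule Suc.IH[OF \<open>open S\<close>, of "\<lambda>x. frechet_derivative f (at x) v"])
      (use Suc.prems(3) eq in auto)
  then show ?case
    using der by (auto simp: differentiable_def)
qed

text \<open>Derivatives on an open set are unique, so the chosen \<open>frechet_derivative\<close>
  in the definition of \<open>Ck_on\<close> may be replaced by any explicit formula. All later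
  proofs of \<open>C^k\<close> regularity by induction go through this rule.\<close>

lemma Ck_on_SucI:
  assumes "open S" and der: "\<And>x. x \<in> S \<Longrightarrow> (f has_derivative f' x) (at x)"
    and "\<And>v. Ck_on k S (\<lambda>x. f' x v)"
  shows "Ck_on (Suc k) S f"
proof -
  have "Ck_on k S (\<lambda>x. frechet_derivative f (at x) v)" for v
    using assms(3)[of v] by (rule Ck_on_cong[OF \<open>open S\<close>, rotated]) (metis der frechet_derivative_at)
  then show ?thesis
    using der by (auto simp: differentiable_def)
qed

lemma Ck_on_has_derivative:
  "Ck_on (Suc k) S f \<Longrightarrow> x \<in> S \<Longrightarrow> (f has_derivative frechet_derivative f (at x)) (at x)"
  using frechet_derivative_works by auto

lemma Ck_on_Suc_imp: "Ck_on (Suc k) S f \<Longrightarrow> Ck_on k S f"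
proof (induction k arbitrary: f)
  case 0
  then show ?case
    by (auto intro!: continuous_at_imp_continuous_on differentiable_imp_continuous_within)
next
  case (Suc k)
  then show ?case by (metis Ck_on.simps(2))
qed

lemma Ck_on_subset: "Ck_on k S f \<Longrightarrow> T \<subseteq> S \<Longrightarrow> Ck_on k T f"
  by (induction k arbitrary: f) (auto intro: continuous_on_subset)

lemma Ck_on_const: "open S \<Longrightarrow> Ck_on k S (\<lambda>x. c)"
proof (induction k arbitrary: c)
  case (Suc k)
  show ?case
    by (rule Ck_on_SucI[OF \<open>open S\<close>, where f' = "\<lambda>x v. 0"]) (auto intro: Suc)
qed simp

lemma bounded_linear_Ck_on:
  assumes "bounded_linear L" and "open S"
  shows "Ck_on k S L"
proof (cases k)
  case 0
  then show ?thesis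
    by (simp add: assms linear_continuous_on)
next
  case (Suc n)
  then show ?thesis
    by (simp del: Ck_on.simps) (rule Ck_on_SucI[where f' = "\<lambda>x. L"], auto intro: Ck_on_const assms
        bounded_linear.has_derivative[OF assms(1) has_derivative_ident])
qed

lemma Ck_on_add:
  assumes "open S" and "Ck_on k S f" and "Ck_on k S g"
  shows "Ck_on k S (\<lambda>x. f x + g x)"
  using assms(2,3)
proof (induction k arbitrary: f g)
  case (Suc k)
  show ?case
  proof (rule Ck_on_SucI[OF \<open>open S\<close>])
    show "((\<lambda>x. f x + g x) has_derivative
        (\<lambda>v. frechet_derivative f (at x) v + frechet_derivative g (at x) v)) (at x)"
      if "x \<in> S" for x
      using Suc.prems that by (intro has_derivative_add Ck_on_has_derivative)
  qed (use Suc in auto)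
qed (auto intro: continuous_on_add)

lemma Ck_on_bounded_linear:
  assumes L: "bounded_linear L" and "open S" and "Ck_on k S f"
  shows "Ck_on k S (\<lambda>x. L (f x))"
  using assms(3)
proof (induction k arbitrary: f)
  case 0
  then show ?case by (simp add: L bounded_linear.continuous_on)
next
  case (Suc k)
  show ?case
  proof (rule Ck_on_SucI[OF \<open>open S\<close>])
    show "((\<lambda>x. L (f x)) has_derivative (\<lambda>v. L (frechet_derivative f (at x) v))) (at x)"
      if "x \<in> S" for x
      using Suc.prems that by (intro bounded_linear.has_derivative[OF L] Ck_on_has_derivative)
  qed (use Suc in auto)
qed

text \<open>The Leibniz rule pairs a differentiated factor with an undifferentiated one, so the
  induction hypothesis is needed for new pairs of maps, the undifferentiated factor being lowered to
  order \<open>k\<close>. Scaling, real products and \<open>lorentz\<close> are all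
  instances.\<close>

lemma Ck_on_bounded_bilinear:
  assumes B: "bounded_bilinear B" and "open S" and "Ck_on k S f" and "Ck_on k S g"
  shows "Ck_on k S (\<lambda>x. B (f x) (g x))"
  using assms(3,4)
proof (induction k arbitrary: f g)
  case 0
  then show ?case by (simp add: B bounded_bilinear.continuous_on)
next
  case (Suc k)
  show ?case
  proof (rule Ck_on_SucI[OF \<open>open S\<close>])
    show "((\<lambda>x. B (f x) (g x)) has_derivative
        (\<lambda>v. B (f x) (frechet_derivative g (at x) v) + B (frechet_derivative f (at x) v) (g x)))
        (at x)" if "x \<in> S" for x
      using Suc.prems that by (intro bounded_bilinear.FDERIV[OF B] Ck_on_has_derivative)
    show "Ck_on k S (\<lambda>x. B (f x) (frechet_derivative g (at x) v) +
        B (frechet_derivative f (at x) v) (g x))" for v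
      using Suc.prems Ck_on_Suc_imp[OF Suc.prems(1)] Ck_on_Suc_imp[OF Suc.prems(2)]
      by (intro Ck_on_add[OF \<open>open S\<close>] Suc.IH) auto
  qed
qed

lemma Ck_on_sum:
  assumes "open S" and "finite I" and "\<And>i. i \<in> I \<Longrightarrow> Ck_on k S (f i)"
  shows "Ck_on k S (\<lambda>x. \<Sum>i\<in>I. f i x)"
  using assms(2,3) by (induction I) (auto intro: Ck_on_const Ck_on_add assms(1))

text \<open>In the chain rule the derivative of \<open>g\<close> is applied to a direction that
  moves with \<open>x\<close>, whereas \<open>Ck_on\<close> controls derivatives in fixed directions
  only. Expanding the moving direction in \<open>Basis\<close> turns the derivative into a finite
  sum of products, to which the induction hypothesis applies.\<close>

lemma Ck_on_compose:
  assumes "open S" and "open T" and "f ` S \<subseteq> T" and "Ck_on k S f" and "Ck_on k T g"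
  shows "Ck_on k S (g \<circ> f)"
  using assms(4,5)
proof (induction k arbitrary: g)
  case 0
  then show ?case using assms(3) by (auto intro: continuous_on_compose2)
next
  case (Suc k)
  let ?f' = "\<lambda>x. frechet_derivative f (at x)" and ?g' = "\<lambda>y. frechet_derivative g (at y)"
  show ?case
  proof (rule Ck_on_SucI[OF \<open>open S\<close>])
    fix x assume x: "x \<in> S"
    have f: "(f has_derivative ?f' x) (at x)" and g: "(g has_derivative ?g' (f x)) (at (f x))"
      using Suc.prems Ck_on_has_derivative x assms(3) by blast+
    have sum: "?g' (f x) w = (\<Sum>b\<in>Basis. (w \<bullet> b) *\<^sub>R ?g' (f x) b)" for w
      using linear_sum[OF has_derivative_linear[OF g], of "\<lambda>b. (w \<bullet> b) *\<^sub>R b" Basis]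
      by (simp add: euclidean_representation linear_cmul[OF has_derivative_linear[OF g]])
    have "?g' (f x) \<circ> ?f' x = (\<lambda>v. \<Sum>b\<in>Basis. (?f' x v \<bullet> b) *\<^sub>R ?g' (f x) b)"
      by (rule ext, unfold o_apply, rule sum)
    then show "(g \<circ> f has_derivative (\<lambda>v. \<Sum>b\<in>Basis. (?f' x v \<bullet> b) *\<^sub>R ?g' (f x) b)) (at x)"
      using diff_chain_at[OF f g] by simp
  next
    fix v
    have "Ck_on k S (G \<circ> f)" if "Ck_on k T G" for G :: "'b \<Rightarrow> 'c"
      using Suc.IH[OF Ck_on_Suc_imp[OF Suc.prems(1)] that] .
    then have "Ck_on k S (\<lambda>x. ?g' (f x) b)" for b
      using Suc.prems(2) unfolding Ck_on.simps o_def by blast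
    moreover have "Ck_on k S (\<lambda>x. ?f' x v \<bullet> b)" for b
      by (rule Ck_on_bounded_linear[OF bounded_linear_inner_left \<open>open S\<close>]) (use Suc.prems(1) in simp)
    ultimately show "Ck_on k S (\<lambda>x. \<Sum>b\<in>Basis. (?f' x v \<bullet> b) *\<^sub>R ?g' (f x) b)"
      by (intro Ck_on_sum Ck_on_bounded_bilinear[OF bounded_bilinear_scaleR] \<open>open S\<close>) auto
  qed
qed

lemma Ck_on_Pair:
  assumes "open S" and "Ck_on k S f" and "Ck_on k S g"
  shows "Ck_on k S (\<lambda>x. (f x, g x))"
proof -
  have "Ck_on k S (\<lambda>x. (f x, 0) + (0, g x))"
    by (intro Ck_on_add assms Ck_on_bounded_linear[OF _ assms(1,2), where L = "\<lambda>u. (u, 0)"]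
        Ck_on_bounded_linear[OF _ assms(1,3), where L = "\<lambda>u. (0, u)"] bounded_linear_Pair
        bounded_linear_ident bounded_linear_zero)
  then show ?thesis by simp
qed

lemma Ck_on_vector_SucI:
  fixes f :: "real \<Rightarrow> 'a::euclidean_space"
  assumes "open S" and "\<And>x. x \<in> S \<Longrightarrow> (f has_vector_derivative f' x) (at x)" and "Ck_on k S f'"
  shows "Ck_on (Suc k) S f"
  using assms(2) unfolding has_vector_derivative_def
  by (rule Ck_on_SucI[OF assms(1)])
    (auto intro: Ck_on_bounded_linear[OF bounded_linear_scaleR_right assms(1,3)])

text \<open>Bootstrapping: the derivative is minus the square of the function itself, so order
  \<open>k\<close> of the function yields order \<open>k\<close> of its derivative.\<close>

lemma Ck_on_real_inverse: "Ck_on k {0<..} (inverse :: real \<Rightarrow> real)"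
proof (induction k)
  case (Suc k)
  have "Ck_on k {0<..} (\<lambda>x::real. - (inverse x * inverse x))"
    by (rule Ck_on_bounded_linear[OF bounded_linear_minus[OF bounded_linear_ident]],
        simp, rule Ck_on_bounded_bilinear[OF bounded_bilinear_mult]) (simp_all add: Suc)
  then show ?case
    by (rule Ck_on_vector_SucI[rotated 2])
      (auto intro!: derivative_eq_intros simp: has_real_derivative_iff_has_vector_derivative[symmetric])
qed (auto intro!: continuous_intros)

text \<open>The same bootstrapping, now from the derivative \<open>inverse (sqrt x) / 2\<close>,
  which is expressed through \<open>sqrt\<close> again.\<close>

lemma Ck_on_sqrt: "Ck_on k {0<..} sqrt"
proof (induction k)
  case (Suc k)
  have "Ck_on k {0<..} (inverse \<circ> sqrt)"
    by (rule Ck_on_compose[where T = "{0<..}"]) (auto intro: Suc Ck_on_real_inverse)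
  then have "Ck_on k {0<..} (\<lambda>x. (inverse \<circ> sqrt) x / 2)"
    by (rule Ck_on_bounded_linear[OF bounded_linear_divide, rotated]) simp
  then show ?case
    by (rule Ck_on_vector_SucI[rotated 2])
      (auto intro!: derivative_eq_intros simp: has_real_derivative_iff_has_vector_derivative[symmetric])
qed (auto intro!: continuous_intros)

section \<open>Mixed partial derivatives\<close>

text \<open>The mean value theorem is applied twice: in the first variable to
  \<open>\<lambda>t. h (t, b+s) - h (t, b)\<close>, then in the second variable to
  \<open>hx (x, t)\<close>.\<close>

lemma second_difference_mean_value:
  fixes h hx hxy :: "real \<times> real \<Rightarrow> real"
  assumes "s > 0"
    and hx: "\<And>x y. x \<in> {a..a+s} \<Longrightarrow> y \<in> {b..b+s} \<Longrightarrow>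
      ((\<lambda>t. h (t, y)) has_real_derivative hx (x, y)) (at x)"
    and hxy: "\<And>x y. x \<in> {a..a+s} \<Longrightarrow> y \<in> {b..b+s} \<Longrightarrow>
      ((\<lambda>t. hx (x, t)) has_real_derivative hxy (x, y)) (at y)"
  shows "\<exists>x\<in>{a..a+s}. \<exists>y\<in>{b..b+s}.
    h (a+s, b+s) - h (a+s, b) - h (a, b+s) + h (a, b) = s * s * hxy (x, y)"
proof -
  have "\<exists>x>a. x < a+s \<and> (h (a+s, b+s) - h (a+s, b)) - (h (a, b+s) - h (a, b)) =
      (a + s - a) * (hx (x, b+s) - hx (x, b))"
    using \<open>s > 0\<close>
    by (intro MVT2[where f = "\<lambda>t. h (t, b+s) - h (t, b)"]) (auto intro!: DERIV_diff hx)
  then obtain x where "a < x" "x < a+s" and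
      "(h (a+s, b+s) - h (a+s, b)) - (h (a, b+s) - h (a, b)) = (a + s - a) * (hx (x, b+s) - hx (x, b))"
    by blast
  then have x: "x \<in> {a..a+s}"
      "h (a+s, b+s) - h (a+s, b) - h (a, b+s) + h (a, b) = s * (hx (x, b+s) - hx (x, b))"
    by auto
  have "\<exists>y>b. y < b+s \<and> hx (x, b+s) - hx (x, b) = (b + s - b) * hxy (x, y)"
    using \<open>s > 0\<close> x(1) by (intro MVT2[where f = "\<lambda>t. hx (x, t)"]) (auto intro!: hxy)
  then obtain y where "b < y" "y < b+s" "hx (x, b+s) - hx (x, b) = s * hxy (x, y)"
    by auto
  with x show ?thesis by (intro bexI[of _ x] bexI[of _ y]) auto
qed

text \<open>Schwarz's theorem. The second difference over a small square is symmetric in the two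
  variables, so it equals the area times a value of \<open>hxy\<close> and also times a value of
  \<open>hyx\<close>; continuity at \<open>p\<close> forbids a gap between them.\<close>

lemma mixed_real_partials_eq:
  fixes h hx hy hxy hyx :: "real \<times> real \<Rightarrow> real"
  assumes "open D" and "p \<in> D"
    and hx: "\<And>x y. (x, y) \<in> D \<Longrightarrow> ((\<lambda>t. h (t, y)) has_real_derivative hx (x, y)) (at x)"
    and hy: "\<And>x y. (x, y) \<in> D \<Longrightarrow> ((\<lambda>t. h (x, t)) has_real_derivative hy (x, y)) (at y)"
    and hxy: "\<And>x y. (x, y) \<in> D \<Longrightarrow> ((\<lambda>t. hx (x, t)) has_real_derivative hxy (x, y)) (at y)"
    and hyx: "\<And>x y. (x, y) \<in> D \<Longrightarrow> ((\<lambda>t. hy (t, y)) has_real_derivative hyx (x, y)) (at x)"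
    and cont: "isCont hxy p" "isCont hyx p"
  shows "hxy p = hyx p"
proof (rule ccontr)
  obtain a b where p: "p = (a, b)" by (cases p)
  assume "hxy p \<noteq> hyx p"
  \<comment> \<open>Half the gap: two errors below \<open>e\<close> then cannot add up to
    it.\<close>
  define e where "e = \<bar>hxy p - hyx p\<bar> / 2"
  have "e > 0" using \<open>hxy p \<noteq> hyx p\<close> by (simp add: e_def)
  have "\<forall>\<^sub>F q in nhds p. q \<in> D \<and> dist (hxy q) (hxy p) < e \<and> dist (hyx q) (hyx p) < e"
    using assms(1,2) cont \<open>e > 0\<close>
    by (intro eventually_conj eventually_nhds_in_open tendstoD) (auto simp: isCont_def tendsto_at_iff_tendsto_nhds)
  then obtain d where "d > 0" and d: "\<And>q. dist q p < d \<Longrightarrow>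
      q \<in> D \<and> dist (hxy q) (hxy p) < e \<and> dist (hyx q) (hyx p) < e"
    unfolding eventually_nhds_metric by blast
  \<comment> \<open>Points of the square of side \<open>s\<close> at \<open>p\<close> lie within
    \<open>2 * s\<close> of \<open>p\<close>, which is less than \<open>d\<close>.\<close>
  define s where "s = d / 3"
  have "s > 0" using \<open>d > 0\<close> by (simp add: s_def)
  have near: "dist (x, y) p < d" if "x \<in> {a..a+s}" "y \<in> {b..b+s}" for x y
  proof -
    have "dist (x, y) p \<le> \<bar>x - a\<bar> + \<bar>y - b\<bar>"
      unfolding p dist_Pair_Pair dist_real_def
      using sqrt_sum_squares_le_sum_abs[of "\<bar>x - a\<bar>" "\<bar>y - b\<bar>"] by simp
    also have "\<dots> \<le> 2 * s" using that by auto
    also have "\<dots> < d" using \<open>d > 0\<close> by (simp add: s_def)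
    finally show ?thesis .
  qed
  have inD: "(x, y) \<in> D" if "x \<in> {a..a+s}" "y \<in> {b..b+s}" for x y
    using d near[OF that] by blast
  let ?\<Delta> = "h (a+s, b+s) - h (a+s, b) - h (a, b+s) + h (a, b)"
  obtain x y where xy: "x \<in> {a..a+s}" "y \<in> {b..b+s}" "?\<Delta> = s * s * hxy (x, y)"
    using second_difference_mean_value[OF \<open>s > 0\<close>, of a b h hx hxy] hx hxy inD by blast
  \<comment> \<open>Exchanging the coordinates by \<open>prod.swap\<close> leaves the second
    difference unchanged and produces the other mixed derivative.\<close>
  obtain x' y' where xy': "x' \<in> {a..a+s}" "y' \<in> {b..b+s}" "?\<Delta> = s * s * hyx (x', y')"
  proof -
    have "\<exists>y\<in>{b..b+s}. \<exists>x\<in>{a..a+s}.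
        h (a+s, b+s) - h (a, b+s) - h (a+s, b) + h (a, b) = s * s * hyx (x, y)"
      using second_difference_mean_value[OF \<open>s > 0\<close>, of b a "h \<circ> prod.swap" "hy \<circ> prod.swap"
          "hyx \<circ> prod.swap"] hy hyx inD by auto
    then show ?thesis using that by (auto simp: algebra_simps)
  qed
  have "hxy (x, y) = hyx (x', y')" using xy(3) xy'(3) \<open>s > 0\<close> by simp
  moreover have "dist (hxy (x, y)) (hxy p) < e" "dist (hyx (x', y')) (hyx p) < e"
    using d near xy(1,2) xy'(1,2) by blast+
  ultimately have "dist (hxy p) (hyx p) < e + e"
    by (metis dist_commute dist_triangle_less_add)
  then show False by (simp add: e_def dist_real_def)
qed

section \<open>Partial derivatives of smooth maps of two variables\<close>

lemma has_derivative_partials: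
  assumes "(h has_derivative h') (at p)"
  shows "((\<lambda>t. h (t, snd p)) has_vector_derivative h' (1, 0)) (at (fst p))"
    and "((\<lambda>t. h (fst p, t)) has_vector_derivative h' (0, 1)) (at (snd p))"
proof -
  have lin: "h' (t, 0) = t *\<^sub>R h' (1, 0)" "h' (0, t) = t *\<^sub>R h' (0, 1)" for t
    using linear_cmul[OF has_derivative_linear[OF assms], of t "(1, 0)"]
      linear_cmul[OF has_derivative_linear[OF assms], of t "(0, 1)"] by simp_all
  have "((\<lambda>t. (t, snd p)) has_derivative (\<lambda>t. (t, 0))) (at (fst p))"
    and "((\<lambda>t. (fst p, t)) has_derivative (\<lambda>t. (0, t))) (at (snd p))"
    by (auto intro!: derivative_eq_intros)
  then show "((\<lambda>t. h (t, snd p)) has_vector_derivative h' (1, 0)) (at (fst p))"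
    and "((\<lambda>t. h (fst p, t)) has_vector_derivative h' (0, 1)) (at (snd p))"
    using has_derivative_compose[of "\<lambda>t. (t, snd p)" _ "fst p" UNIV h h']
      has_derivative_compose[of "\<lambda>t. (fst p, t)" _ "snd p" UNIV h h'] assms
    unfolding has_vector_derivative_def by (simp_all add: lin[symmetric])
qed

lemma partials_eq_derivative:
  assumes "(h has_derivative h') (at p)"
  shows "partial_x h p = h' (1, 0)" and "partial_y h p = h' (0, 1)"
  using has_derivative_partials[OF assms]
  by (simp_all add: partial_x_def partial_y_def vector_derivative_at)

lemma smooth_on_has_derivative:
  "smooth_on S f \<Longrightarrow> x \<in> S \<Longrightarrow> (f has_derivative frechet_derivative f (at x)) (at x)"
  unfolding smooth_on_def using Ck_on_has_derivative by blast

lemma smooth_on_imp_isCont: "smooth_on S f \<Longrightarrow> x \<in> S \<Longrightarrow> isCont f x"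
  by (metis smooth_on_has_derivative has_derivative_continuous)

lemma smooth_on_cong:
  "open S \<Longrightarrow> (\<And>x. x \<in> S \<Longrightarrow> f x = g x) \<Longrightarrow> smooth_on S f \<Longrightarrow> smooth_on S g"
  unfolding smooth_on_def using Ck_on_cong by blast

lemma smooth_on_compose:
  "open S \<Longrightarrow> open T \<Longrightarrow> f ` S \<subseteq> T \<Longrightarrow> smooth_on S f \<Longrightarrow> smooth_on T g \<Longrightarrow> smooth_on S (g \<circ> f)"
  unfolding smooth_on_def using Ck_on_compose by blast

lemma smooth_on_bounded_bilinear:
  "bounded_bilinear B \<Longrightarrow> open S \<Longrightarrow> smooth_on S f \<Longrightarrow> smooth_on S g \<Longrightarrow>
    smooth_on S (\<lambda>x. B (f x) (g x))"
  unfolding smooth_on_def using Ck_on_bounded_bilinear by blast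

lemma smooth_on_partials:
  assumes "open D" and "smooth_on D h"
  shows "smooth_on D (partial_x h)" and "smooth_on D (partial_y h)"
proof -
  have *: "smooth_on D (\<lambda>p. frechet_derivative h (at p) v)" for v
    using assms(2) unfolding smooth_on_def by (metis Ck_on.simps(2))
  show "smooth_on D (partial_x h)" and "smooth_on D (partial_y h)"
    by (rule smooth_on_cong[OF \<open>open D\<close> _ *[of "(1, 0)"]],
        simp add: partials_eq_derivative[OF smooth_on_has_derivative[OF assms(2)]])
      (rule smooth_on_cong[OF \<open>open D\<close> _ *[of "(0, 1)"]],
        simp add: partials_eq_derivative[OF smooth_on_has_derivative[OF assms(2)]])
qed

lemma smooth_on_has_partials:
  assumes "smooth_on D h" and "p \<in> D"
  shows "((\<lambda>t. h (t, snd p)) has_vector_derivative partial_x h p) (at (fst p))"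
    and "((\<lambda>t. h (fst p, t)) has_vector_derivative partial_y h p) (at (snd p))"
  using has_derivative_partials[OF smooth_on_has_derivative[OF assms]]
  by (simp_all add: partials_eq_derivative[OF smooth_on_has_derivative[OF assms]])

lemma partials_commute:
  fixes h :: "real \<times> real \<Rightarrow> 'a::euclidean_space"
  assumes "open D" and "smooth_on D h" and "p \<in> D"
  shows "partial_x (partial_y h) p = partial_y (partial_x h) p"
proof (rule euclidean_eqI)
  fix b :: 'a
  note sx = smooth_on_partials(1)[OF \<open>open D\<close>] and sy = smooth_on_partials(2)[OF \<open>open D\<close>]
  note h = \<open>smooth_on D h\<close>
  have x: "((\<lambda>t. f (t, y) \<bullet> b) has_real_derivative partial_x f (x, y) \<bullet> b) (at x)"
    and y: "((\<lambda>t. f (x, t) \<bullet> b) has_real_derivative partial_y f (x, y) \<bullet> b) (at y)"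
    if "smooth_on D f" "(x, y) \<in> D" for f :: "real \<times> real \<Rightarrow> 'a" and x y
    using smooth_on_has_partials[OF that]
    by (auto simp: has_real_derivative_iff_has_vector_derivative
        intro: bounded_linear.has_vector_derivative[OF bounded_linear_inner_left])
  have "partial_y (partial_x h) p \<bullet> b = partial_x (partial_y h) p \<bullet> b"
    by (rule mixed_real_partials_eq[OF \<open>open D\<close> \<open>p \<in> D\<close>, of "\<lambda>q. h q \<bullet> b"
          "\<lambda>q. partial_x h q \<bullet> b" "\<lambda>q. partial_y h q \<bullet> b"])
      (auto intro!: x y continuous_intros intro: sx sy h
        smooth_on_imp_isCont[OF _ \<open>p \<in> D\<close>])
  then show "partial_x (partial_y h) p \<bullet> b = partial_y (partial_x h) p \<bullet> b" ..
qed

lemma partials_cong: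
  assumes "open D" and "p \<in> D" and "\<And>q. q \<in> D \<Longrightarrow> f q = g q"
  shows "partial_x f p = partial_x g p" and "partial_y f p = partial_y g p"
proof -
  have "open ((\<lambda>t. (t, snd p)) -` D)" "open ((\<lambda>t. (fst p, t)) -` D)"
    by (auto intro!: open_vimage continuous_intros \<open>open D\<close>)
  then have "\<forall>\<^sub>F t in nhds (fst p). f (t, snd p) = g (t, snd p)"
    and "\<forall>\<^sub>F t in nhds (snd p). f (fst p, t) = g (fst p, t)"
    using assms(2,3) by (auto simp: eventually_nhds intro: exI[of _ "(\<lambda>t. (t, snd p)) -` D"]
        exI[of _ "(\<lambda>t. (fst p, t)) -` D"])
  then show "partial_x f p = partial_x g p" and "partial_y f p = partial_y g p"
    unfolding partial_x_def partial_y_def by (auto intro!: vector_derivative_cong_eq)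
qed


section \<open>Reparametrization of an interval with prescribed speed\<close>

lemma strict_mono_on_pos_derivative:
  fixes X a :: "real \<Rightarrow> real"
  assumes X: "\<And>x. x \<in> {c..d} \<Longrightarrow> (X has_vector_derivative a x) (at x within {c..d})"
    and "\<And>x. x \<in> {c..d} \<Longrightarrow> a x > 0"
  shows "strict_mono_on {c..d} X"
proof (rule strict_mono_onI)
  fix x y assume xy: "x \<in> {c..d}" "y \<in> {c..d}" "x < y"
  have "\<exists>t\<in>{x<..<y}. X y - X x = (y - x) *\<^sub>R a t"
    using xy(1,2) X unfolding has_vector_derivative_def
    by (intro mvt_simple[OF \<open>x < y\<close>] has_derivative_subset[of X _ _ "{c..d}" "{x..y}"]) auto
  then obtain t where "t \<in> {x<..<y}" "X y - X x = (y - x) * a t" by auto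
  moreover have "(y - x) * a t > 0" using xy calculation assms(2)[of t] by auto
  ultimately show "X x < X y" by simp
qed

text \<open>\<open>X\<close> is an antiderivative of \<open>a\<close> and \<open>Y\<close> its
  inverse. The closed interval inside \<open>S\<close> makes \<open>X\<close> continuous up to both
  ends, so the image of the open interval is exactly the open interval from \<open>X c\<close> to
  \<open>X d\<close>.\<close>

lemma smooth_reparametrization:
  fixes a :: "real \<Rightarrow> real"
  assumes "c < d" and "open S" and S: "{c..d} \<subseteq> S" and "smooth_on S a"
    and pos: "\<And>x. x \<in> S \<Longrightarrow> a x > 0"
  obtains X Y \<alpha> \<beta> where "diffeomorphism {c<..<d} {\<alpha><..<\<beta>} X Y"
    and "smooth_on {\<alpha><..<\<beta>} (\<lambda>u. inverse (a (Y u)))"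
    and "\<And>u. u \<in> {\<alpha><..<\<beta>} \<Longrightarrow> (Y has_real_derivative inverse (a (Y u))) (at u)"
proof -
  let ?I = "{c<..<d}"
  have Ck_a: "Ck_on k S a" for k using \<open>smooth_on S a\<close> by (simp add: smooth_on_def)
  have "continuous_on {c..d} a" using Ck_on_subset[OF Ck_a[of 0] S] by simp
  then obtain X where X: "\<And>x. x \<in> {c..d} \<Longrightarrow> (X has_vector_derivative a x) (at x within {c..d})"
    by (rule antiderivative_continuous) blast
  have X_at: "(X has_vector_derivative a x) (at x)" if "x \<in> ?I" for x
    using X[of x] that by (simp add: at_within_Icc_at)
  have contX: "continuous_on {c..d} X"
    using X has_vector_derivative_continuous continuous_on_eq_continuous_within by blast
  have mono: "strict_mono_on {c..d} X"
    using strict_mono_on_pos_derivative[OF X] pos S by blast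
  then have inj: "inj_on X {c..d}" by (rule strict_mono_on_imp_inj_on)
  define Y where "Y = the_inv_into {c..d} X"
  let ?J = "{X c<..<X d}"
  have YX: "Y (X x) = x" if "x \<in> {c..d}" for x
    using that by (simp add: Y_def the_inv_into_f_f inj)
  have img: "X ` ?I = ?J"
  proof
    show "X ` ?I \<subseteq> ?J" using strict_mono_onD[OF mono] by auto
    show "?J \<subseteq> X ` ?I"
    proof
      fix u assume u: "u \<in> ?J"
      then obtain x where "c \<le> x" "x \<le> d" "X x = u"
        using IVT'[of X c u d] contX \<open>c < d\<close> by auto
      moreover have "x \<noteq> c" "x \<noteq> d" using u \<open>X x = u\<close> by auto
      ultimately show "u \<in> X ` ?I" by force
    qed
  qed
  have Y: "Y u \<in> ?I" "X (Y u) = u" if "u \<in> ?J" for u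
    using that YX unfolding img[symmetric] by auto
  have YS: "Y u \<in> S" if "u \<in> ?J" for u
    using Y(1)[OF that] S by (auto simp: subset_iff)
  have "continuous_on (X ` {c..d}) Y"
    by (rule continuous_on_inv[OF contX]) (auto simp: YX)
  then have contY: "continuous_on ?J Y"
    by (rule continuous_on_subset) (force simp: img[symmetric])
  have derY: "(Y has_real_derivative inverse (a (Y u))) (at u)" if "u \<in> ?J" for u
  proof (rule DERIV_inverse_function[where f = X and a = "X c" and b = "X d"])
    show "(X has_real_derivative a (Y u)) (at (Y u))"
      using X_at[OF Y(1)[OF that]] by (simp add: has_real_derivative_iff_has_vector_derivative)
    show "a (Y u) \<noteq> 0" using pos[OF YS[OF that]] by simp
    show "isCont Y u" using contY that by (simp add: continuous_on_eq_continuous_at)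
  qed (use that Y in auto)
  have Ck_X: "Ck_on k ?I X" for k
    by (rule Ck_on_Suc_imp, rule Ck_on_vector_SucI[OF _ X_at])
      (use Ck_on_subset[OF Ck_on_subset[OF Ck_a S], of ?I] in \<open>auto simp: subset_iff\<close>)
  have Ck_inv: "Ck_on k ?J (\<lambda>u. inverse (a (Y u)))" if "Ck_on k ?J Y" for k
  proof -
    have "Ck_on k ?J (a \<circ> Y)"
      by (rule Ck_on_compose[OF open_greaterThanLessThan \<open>open S\<close> _ that Ck_a]) (use YS in blast)
    then have "Ck_on k ?J (inverse \<circ> (a \<circ> Y))"
      by (rule Ck_on_compose[OF open_greaterThanLessThan open_greaterThan _ _ Ck_on_real_inverse,
            rotated]) (use YS pos in auto)
    then show ?thesis by (simp add: o_def)
  qed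
  \<comment> \<open>\<open>Y\<close> solves the differential equation
    \<open>Y' = inverse (a (Y u))\<close>; if \<open>Y\<close> has order \<open>k\<close>, so has
    the right-hand side, and \<open>Y\<close> gains one order.\<close>
  have Ck_Y: "Ck_on k ?J Y" for k
  proof (induction k)
    case 0
    show ?case using contY by simp
  next
    case (Suc k)
    show ?case
      using derY Ck_inv[OF Suc]
      by (intro Ck_on_vector_SucI[where f' = "\<lambda>u. inverse (a (Y u))"])
        (auto simp: has_real_derivative_iff_has_vector_derivative)
  qed
  show thesis
  proof
    have "homeomorphism ?I ?J X Y"
    proof (rule homeomorphismI)
      show "continuous_on ?I X" using contX by (rule continuous_on_subset) auto
      show "Y ` ?J \<subseteq> ?I" using Y(1) by blast
    qed (use contY img YX Y(2) in auto)
    then show "diffeomorphism ?I ?J X Y"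
      using Ck_X Ck_Y by (simp add: diffeomorphism_def smooth_on_def)
    show "smooth_on ?J (\<lambda>u. inverse (a (Y u)))"
      using Ck_inv[OF Ck_Y] by (simp add: smooth_on_def)
  qed (rule derY)
qed

section \<open>Surfaces in principal parameters\<close>

lemma bounded_bilinear_lorentz: "bounded_bilinear lorentz"
  unfolding bilinear_conv_bounded_bilinear[symmetric] bilinear_def linear_iff lorentz_def
  by (auto simp: algebra_simps)

lemmas lorentz_simps =
  bounded_bilinear.add_left[OF bounded_bilinear_lorentz]
  bounded_bilinear.add_right[OF bounded_bilinear_lorentz]
  bounded_bilinear.scaleR_left[OF bounded_bilinear_lorentz]
  bounded_bilinear.scaleR_right[OF bounded_bilinear_lorentz]
  bounded_bilinear.minus_left[OF bounded_bilinear_lorentz]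
  bounded_bilinear.minus_right[OF bounded_bilinear_lorentz]
  bounded_bilinear.zero_left[OF bounded_bilinear_lorentz]
  bounded_bilinear.zero_right[OF bounded_bilinear_lorentz]

lemma lorentz_commute: "lorentz a b = lorentz b a"
  by (simp add: lorentz_def)

text \<open>The Lorentz product with \<open>w\<close> is the Euclidean product with \<open>w\<close>
  after flipping its third entry. The hypotheses thus put the flipped vector into the kernel of the
  invertible matrix with rows \<open>a\<close>, \<open>b\<close>, \<open>c\<close>.\<close>

lemma lorentz_orthogonal_frame_eq_0:
  assumes "det (vector [a, b, c] :: real^3^3) \<noteq> 0"
    and "lorentz w a = 0" and "lorentz w b = 0" and "lorentz w c = 0"
  shows "w = 0"
proof -
  let ?A = "vector [a, b, c] :: real^3^3" and ?w = "vector [w$1, w$2, - w$3] :: real^3"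
  have "?A *v ?w = 0"
    using assms(2-4) by (simp add: vec_eq_iff forall_3 matrix_vector_mult_def sum_3 lorentz_def algebra_simps)
  moreover have "invertible ?A"
    using assms(1) by (simp add: invertible_det_nz)
  ultimately have "?w = 0"
    using matrix_left_invertible_ker invertible_def by blast
  then show ?thesis by (simp add: vec_eq_iff forall_3)
qed

lemma partials_bounded_bilinear:
  assumes "bounded_bilinear B" and "smooth_on D f" and "smooth_on D g" and "p \<in> D"
  shows "partial_x (\<lambda>q. B (f q) (g q)) p = B (f p) (partial_x g p) + B (partial_x f p) (g p)"
    and "partial_y (\<lambda>q. B (f q) (g q)) p = B (f p) (partial_y g p) + B (partial_y f p) (g p)"
  using bounded_bilinear.has_vector_derivative[OF assms(1) smooth_on_has_partials(1)[OF assms(2,4)]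
      smooth_on_has_partials(1)[OF assms(3,4)]]
    bounded_bilinear.has_vector_derivative[OF assms(1) smooth_on_has_partials(2)[OF assms(2,4)]
      smooth_on_has_partials(2)[OF assms(3,4)]]
  by (simp_all add: partial_x_def[of "\<lambda>q. B (f q) (g q)"] partial_y_def[of "\<lambda>q. B (f q) (g q)"]
      vector_derivative_at)

lemma lorentz_constant_partials:
  assumes "open D" and "smooth_on D f" and "smooth_on D g" and "p \<in> D"
    and "\<And>q. q \<in> D \<Longrightarrow> lorentz (f q) (g q) = c"
  shows "lorentz (f p) (partial_x g p) + lorentz (partial_x f p) (g p) = 0"
    and "lorentz (f p) (partial_y g p) + lorentz (partial_y f p) (g p) = 0"
proof -
  have "partial_x (\<lambda>q. lorentz (f q) (g q)) p = partial_x (\<lambda>q. c) p"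
    and "partial_y (\<lambda>q. lorentz (f q) (g q)) p = partial_y (\<lambda>q. c) p"
    using partials_cong[OF assms(1,4), of "\<lambda>q. lorentz (f q) (g q)" "\<lambda>q. c"] assms(5) by auto
  then show "lorentz (f p) (partial_x g p) + lorentz (partial_x f p) (g p) = 0"
    and "lorentz (f p) (partial_y g p) + lorentz (partial_y f p) (g p) = 0"
    unfolding partials_bounded_bilinear[OF bounded_bilinear_lorentz assms(2-4)]
    by (simp_all add: partial_x_def[of "\<lambda>q. c"] partial_y_def[of "\<lambda>q. c"])
qed

lemma principal_timelike_surfaceD:
  assumes "principal_timelike_surface \<sigma> D z l"
  shows "open D" and "smooth_on D z" and "smooth_on D l"
    and "p \<in> D \<Longrightarrow> coeff_E z p > 0" and "p \<in> D \<Longrightarrow> coeff_G z p > 0"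
    and "p \<in> D \<Longrightarrow> lorentz (partial_x z p) (partial_y z p) = 0"
    and "p \<in> D \<Longrightarrow> lorentz (partial_y (partial_x z) p) (l p) = 0"
    and "p \<in> D \<Longrightarrow> lorentz (l p) (partial_x z p) = 0"
    and "p \<in> D \<Longrightarrow> lorentz (l p) (partial_y z p) = 0"
    and "p \<in> D \<Longrightarrow> lorentz (l p) (l p) = -1"
    and "p \<in> D \<Longrightarrow> \<sigma> * det (vector [partial_x z p, partial_y z p, l p] :: real^3^3) > 0"
    and "p \<in> D \<Longrightarrow> nu1 z l p - nu2 z l p > 0"
proof -
  have pos: "coeff_E z p * a\<^sup>2 + 2 * coeff_F z p * a * b + coeff_G z p * b\<^sup>2 > 0"
    if "p \<in> D" "(a, b) \<noteq> (0, 0)" for a b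
    using assms that by (auto simp: principal_timelike_surface_def timelike_surface_def)
  show "p \<in> D \<Longrightarrow> coeff_E z p > 0" and "p \<in> D \<Longrightarrow> coeff_G z p > 0"
    using pos[of 1 0] pos[of 0 1] by auto
qed (use assms in \<open>auto simp: principal_timelike_surface_def timelike_surface_def unit_normal_def
    principal_net_def coeff_F_def coeff_f_def\<close>)

text \<open>The difference of the two sides is orthogonal to the whole frame. For the
  \<open>x\<close>-derivative: against \<open>z_x\<close> by differentiating
  \<open><l, z_x> = 0\<close>, against \<open>z_y\<close> by differentiating
  \<open><l, z_y> = 0\<close> and using \<open>f = F = 0\<close>, against \<open>l\<close> by
  differentiating \<open><l, l> = -1\<close>.\<close>

lemma Weingarten_principal:
  assumes surf: "principal_timelike_surface \<sigma> D z l" and p: "p \<in> D"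
  shows "partial_x l p = - nu1 z l p *\<^sub>R partial_x z p"
    and "partial_y l p = - nu2 z l p *\<^sub>R partial_y z p"
proof -
  note S = principal_timelike_surfaceD[OF surf]
  have zx: "smooth_on D (partial_x z)" and zy: "smooth_on D (partial_y z)"
    using smooth_on_partials S(1,2) by blast+
  have zyx: "partial_x (partial_y z) p = partial_y (partial_x z) p"
    using partials_commute S(1,2) p by blast
  have det: "det (vector [partial_x z p, partial_y z p, l p] :: real^3^3) \<noteq> 0"
    using S(11)[OF p] by auto
  note lx = lorentz_constant_partials[OF S(1,3) zx p S(8)]
    and ly = lorentz_constant_partials[OF S(1,3) zy p S(9)]
    and ll = lorentz_constant_partials[OF S(1,3,3) p S(10)]
  note orth = lorentz_orthogonal_frame_eq_0[OF det]
  have "partial_x l p + nu1 z l p *\<^sub>R partial_x z p = 0"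
    using S(4-10)[OF p] lx ly ll zyx
    by (intro orth) (auto simp: lorentz_simps nu1_def coeff_e_def coeff_E_def lorentz_commute)
  then show "partial_x l p = - nu1 z l p *\<^sub>R partial_x z p"
    by (simp add: eq_neg_iff_add_eq_0)
  have "partial_y l p + nu2 z l p *\<^sub>R partial_y z p = 0"
    using S(4-10)[OF p] lx ly ll zyx
    by (intro orth) (auto simp: lorentz_simps nu2_def coeff_g_def coeff_G_def lorentz_commute)
  then show "partial_y l p = - nu2 z l p *\<^sub>R partial_y z p"
    by (simp add: eq_neg_iff_add_eq_0)
qed

text \<open>Start from \<open>e_y = <z_xx, l_y> + <z_xxy, l>\<close>. By Weingarten and
  \<open>F_x = 0\<close> the first term is \<open>nu2 <z_x, z_xy>\<close>; by \<open>f_x = 0\<close>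
  and Weingarten the second is \<open>-<z_xy, l_x> = nu1 <z_x, z_xy>\<close>. The computation of
  \<open>g_x\<close> is symmetric, with \<open>F_y\<close> and \<open>f_y\<close>.\<close>

lemma Codazzi_principal:
  assumes surf: "principal_timelike_surface \<sigma> D z l" and p: "p \<in> D"
  shows "partial_y (coeff_e z l) p =
      (nu1 z l p + nu2 z l p) * lorentz (partial_x z p) (partial_y (partial_x z) p)"
    and "partial_x (coeff_g z l) p =
      (nu1 z l p + nu2 z l p) * lorentz (partial_y z p) (partial_y (partial_x z) p)"
proof -
  note S = principal_timelike_surfaceD[OF surf]
  note sm = smooth_on_partials[OF S(1)]
  have zx: "smooth_on D (partial_x z)" and zy: "smooth_on D (partial_y z)"
    using sm S(2) by blast+
  have zxy: "smooth_on D (partial_y (partial_x z))"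
    and zxx: "smooth_on D (partial_x (partial_x z))" and zyy: "smooth_on D (partial_y (partial_y z))"
    using sm zx zy by blast+
  have comm: "partial_x (partial_y z) q = partial_y (partial_x z) q" if "q \<in> D" for q
    using partials_commute S(1,2) that by blast
  have comm_x: "partial_y (partial_x (partial_x z)) p = partial_x (partial_y (partial_x z)) p"
    using partials_commute[OF S(1) zx p] by simp
  \<comment> \<open>Here the mixed derivatives are exchanged under an outer
    \<open>partial_y\<close>, so their equality is needed near \<open>p\<close> and not only at
    \<open>p\<close>.\<close>
  have comm_y: "partial_x (partial_y (partial_y z)) p = partial_y (partial_y (partial_x z)) p"
    using partials_commute[OF S(1) zy p] partials_cong(2)[OF S(1) p comm] by simp
  note W = Weingarten_principal[OF surf p]
  note F = lorentz_constant_partials[OF S(1) zx zy p S(6)]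
    and f = lorentz_constant_partials[OF S(1) zxy S(3) p S(7)]
  have Fx: "lorentz (partial_x (partial_x z) p) (partial_y z p) =
      - lorentz (partial_x z p) (partial_y (partial_x z) p)"
    and Fy: "lorentz (partial_y (partial_y z) p) (partial_x z p) =
      - lorentz (partial_y z p) (partial_y (partial_x z) p)"
    using F unfolding comm[OF p] by (simp_all add: lorentz_commute)
  have "partial_y (coeff_e z l) p = lorentz (partial_x (partial_x z) p) (partial_y l p) +
      lorentz (partial_x (partial_y (partial_x z)) p) (l p)"
    unfolding coeff_e_def[abs_def] comm_x[symmetric]
    by (rule partials_bounded_bilinear(2)[OF bounded_bilinear_lorentz zxx S(3) p])
  then show "partial_y (coeff_e z l) p =
      (nu1 z l p + nu2 z l p) * lorentz (partial_x z p) (partial_y (partial_x z) p)"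
    using Fx f(1) unfolding W
    by (simp add: lorentz_simps lorentz_commute algebra_simps)
  have "partial_x (coeff_g z l) p = lorentz (partial_y (partial_y z) p) (partial_x l p) +
      lorentz (partial_y (partial_y (partial_x z)) p) (l p)"
    unfolding coeff_g_def[abs_def] comm_y[symmetric]
    by (rule partials_bounded_bilinear(1)[OF bounded_bilinear_lorentz zyy S(3) p])
  then show "partial_x (coeff_g z l) p =
      (nu1 z l p + nu2 z l p) * lorentz (partial_y z p) (partial_y (partial_x z) p)"
    using Fy f(2) unfolding W
    by (simp add: lorentz_simps lorentz_commute algebra_simps)
qed

section \<open>Changing each parameter separately\<close>

lemma smooth_on_map_prod:
  assumes "open J" and "open K" and "smooth_on J X" and "smooth_on K Y"
  shows "smooth_on (J \<times> K) (map_prod X Y)"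
proof -
  have "smooth_on (J \<times> K) fst" "smooth_on (J \<times> K) snd"
    using assms(1,2) unfolding smooth_on_def
    by (auto intro!: bounded_linear_Ck_on bounded_linear_fst bounded_linear_snd open_Times)
  then have "smooth_on (J \<times> K) (X \<circ> fst)" "smooth_on (J \<times> K) (Y \<circ> snd)"
    using assms by (auto intro!: smooth_on_compose open_Times)
  then show ?thesis
    using assms(1,2) Ck_on_Pair[OF open_Times, of J K _ "X \<circ> fst" "Y \<circ> snd"]
    unfolding smooth_on_def map_prod_def by (simp add: case_prod_beta')
qed

lemma partials_compose_map_prod:
  assumes "smooth_on D h" and "map_prod X Y q \<in> D"
    and X: "(X has_real_derivative r) (at (fst q))" and Y: "(Y has_real_derivative s) (at (snd q))"
  shows "partial_x (h \<circ> map_prod X Y) q = r *\<^sub>R partial_x h (map_prod X Y q)"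
    and "partial_y (h \<circ> map_prod X Y) q = s *\<^sub>R partial_y h (map_prod X Y q)"
proof -
  note h = smooth_on_has_partials[OF assms(1,2)]
  have X': "(X has_vector_derivative r) (at (fst q))" and Y': "(Y has_vector_derivative s) (at (snd q))"
    using X Y by (simp_all add: has_real_derivative_iff_has_vector_derivative)
  have "((\<lambda>t. h (t, Y (snd q))) \<circ> X has_vector_derivative r *\<^sub>R partial_x h (map_prod X Y q)) (at (fst q))"
    using h(1) by (intro vector_diff_chain_at[OF X']) (simp add: map_prod_def split_beta)
  moreover have "((\<lambda>t. h (X (fst q), t)) \<circ> Y has_vector_derivative s *\<^sub>R partial_y h (map_prod X Y q)) (at (snd q))"
    using h(2) by (intro vector_diff_chain_at[OF Y']) (simp add: map_prod_def split_beta)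
  ultimately show "partial_x (h \<circ> map_prod X Y) q = r *\<^sub>R partial_x h (map_prod X Y q)"
    and "partial_y (h \<circ> map_prod X Y) q = s *\<^sub>R partial_y h (map_prod X Y q)"
    unfolding partial_x_def[of "h \<circ> map_prod X Y"] partial_y_def[of "h \<circ> map_prod X Y"]
    by (simp_all add: o_def vector_derivative_at)
qed

text \<open>The quadratic form at \<open>(a, b)\<close> is the Lorentz square of
  \<open>h' (a, b)\<close>, so a kernel vector of \<open>h'\<close> would be a null vector of a
  definite form.\<close>

lemma inj_derivative_of_definite:
  assumes h: "(h has_derivative h') (at p)"
    and pos: "\<And>a b. (a, b) \<noteq> (0, 0) \<Longrightarrow>
      coeff_E h p * a\<^sup>2 + 2 * coeff_F h p * a * b + coeff_G h p * b\<^sup>2 > 0"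
  shows "inj h'"
proof -
  have lin: "linear h'" using h by (rule has_derivative_linear)
  have "w = 0" if "h' w = 0" for w
  proof (rule ccontr)
    assume "w \<noteq> 0"
    obtain a b where w: "w = (a, b)" by (cases w)
    have "w = a *\<^sub>R (1, 0) + b *\<^sub>R (0, 1)" by (simp add: w)
    then have "h' w = a *\<^sub>R h' (1, 0) + b *\<^sub>R h' (0, 1)"
      by (simp only: linear_add[OF lin] linear_cmul[OF lin])
    then have "lorentz (h' w) (h' w) = coeff_E h p * a\<^sup>2 + 2 * coeff_F h p * a * b + coeff_G h p * b\<^sup>2"
      by (simp add: coeff_E_def coeff_F_def coeff_G_def partials_eq_derivative[OF h] lorentz_simps
          lorentz_commute power2_eq_square algebra_simps)
    with pos[of a b] \<open>w \<noteq> 0\<close> \<open>h' w = 0\<close> w show False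
      by (simp add: lorentz_simps zero_prod_def)
  qed
  then show ?thesis using lin linear_injective_0 by blast
qed

text \<open>Each coordinate direction is kept and stretched by a positive factor: \<open>F\<close>
  and \<open>f\<close> stay zero, \<open>nu1\<close> and \<open>nu2\<close> are unchanged, and the
  determinant of the frame is multiplied by the positive number \<open>r * s\<close>.\<close>

lemma principal_reparametrization:
  assumes surf: "principal_timelike_surface \<sigma> D z l"
    and J: "open J" "connected J" and K: "open K" "connected K"
    and X: "smooth_on J X" "smooth_on J r" "\<And>u. u \<in> J \<Longrightarrow> r u > 0"
      "\<And>u. u \<in> J \<Longrightarrow> (X has_real_derivative r u) (at u)"
    and Y: "smooth_on K Y" "smooth_on K s" "\<And>v. v \<in> K \<Longrightarrow> s v > 0"
      "\<And>v. v \<in> K \<Longrightarrow> (Y has_real_derivative s v) (at v)"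
    and img: "map_prod X Y ` (J \<times> K) \<subseteq> D"
  shows "principal_timelike_surface \<sigma> (J \<times> K) (z \<circ> map_prod X Y) (l \<circ> map_prod X Y)"
    and "q \<in> J \<times> K \<Longrightarrow> coeff_E (z \<circ> map_prod X Y) q = (r (fst q))\<^sup>2 * coeff_E z (map_prod X Y q)"
    and "q \<in> J \<times> K \<Longrightarrow> coeff_G (z \<circ> map_prod X Y) q = (s (snd q))\<^sup>2 * coeff_G z (map_prod X Y q)"
proof -
  note S = principal_timelike_surfaceD[OF surf]
  let ?V = "J \<times> K" and ?\<psi> = "map_prod X Y"
  let ?r = "r \<circ> fst" and ?s = "s \<circ> snd"
  have V: "open ?V" using J(1) K(1) by (rule open_Times)
  have psi: "smooth_on ?V ?\<psi>" using J(1) K(1) X(1) Y(1) by (rule smooth_on_map_prod)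
  have smooth_psi: "smooth_on ?V (h \<circ> ?\<psi>)" if "smooth_on D h" for h :: "real \<times> real \<Rightarrow> real^3"
    using V S(1) img psi that by (rule smooth_on_compose)
  have "smooth_on ?V fst" "smooth_on ?V snd"
    unfolding smooth_on_def
    by (auto intro!: bounded_linear_Ck_on V bounded_linear_fst bounded_linear_snd)
  then have r: "smooth_on ?V ?r" and s: "smooth_on ?V ?s"
    by (auto intro!: smooth_on_compose[OF V J(1) _ _ X(2)] smooth_on_compose[OF V K(1) _ _ Y(2)])
  have inD: "?\<psi> q \<in> D" if "q \<in> ?V" for q using img that by blast
  have px: "partial_x (h \<circ> ?\<psi>) q = ?r q *\<^sub>R (partial_x h \<circ> ?\<psi>) q"
    and py: "partial_y (h \<circ> ?\<psi>) q = ?s q *\<^sub>R (partial_y h \<circ> ?\<psi>) q"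
    if "smooth_on D h" "q \<in> ?V" for h :: "real \<times> real \<Rightarrow> real^3" and q
    using partials_compose_map_prod[OF that(1) inD[OF that(2)] X(4) Y(4)] that(2) by auto
  have zx: "smooth_on D (partial_x z)" and zy: "smooth_on D (partial_y z)"
    using smooth_on_partials S(1,2) by blast+
  note P = px[OF S(2)] py[OF S(2)]
  \<comment> \<open>\<open>?r\<close> depends on the first coordinate only, hence the mixed second
    derivative has no extra term.\<close>
  have pyr: "partial_y ?r q = 0" for q by (simp add: partial_y_def)
  have E: "coeff_E (z \<circ> ?\<psi>) q = (r (fst q))\<^sup>2 * coeff_E z (?\<psi> q)"
    and F: "coeff_F (z \<circ> ?\<psi>) q = 0"
    and G: "coeff_G (z \<circ> ?\<psi>) q = (s (snd q))\<^sup>2 * coeff_G z (?\<psi> q)" if q: "q \<in> ?V" for q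
    using P[OF q] S(6)[OF inD[OF q]]
    by (simp_all add: coeff_E_def coeff_F_def coeff_G_def lorentz_simps power2_eq_square)
  have zxx: "partial_x (partial_x (z \<circ> ?\<psi>)) q =
      ?r q *\<^sub>R ?r q *\<^sub>R partial_x (partial_x z) (?\<psi> q) + partial_x ?r q *\<^sub>R partial_x z (?\<psi> q)"
    and zxy: "partial_y (partial_x (z \<circ> ?\<psi>)) q = ?r q *\<^sub>R ?s q *\<^sub>R partial_y (partial_x z) (?\<psi> q)"
    and zyy: "partial_y (partial_y (z \<circ> ?\<psi>)) q =
      ?s q *\<^sub>R ?s q *\<^sub>R partial_y (partial_y z) (?\<psi> q) + partial_y ?s q *\<^sub>R partial_y z (?\<psi> q)"
    if q: "q \<in> ?V" for q
    using partials_bounded_bilinear[OF bounded_bilinear_scaleR r smooth_psi[OF zx] q]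
      partials_bounded_bilinear[OF bounded_bilinear_scaleR s smooth_psi[OF zy] q]
      px[OF zx q] py[OF zx q] py[OF zy q]
    by (simp_all add: partials_cong[OF V q P(1)] partials_cong[OF V q P(2)] pyr del: o_apply)
      (simp_all add: o_def)
  \<comment> \<open>The terms containing derivatives of \<open>?r\<close> and \<open>?s\<close> are
    tangent to the surface and vanish against the normal.\<close>
  have e: "coeff_e (z \<circ> ?\<psi>) (l \<circ> ?\<psi>) q = (r (fst q))\<^sup>2 * coeff_e z l (?\<psi> q)"
    and f: "coeff_f (z \<circ> ?\<psi>) (l \<circ> ?\<psi>) q = 0"
    and g: "coeff_g (z \<circ> ?\<psi>) (l \<circ> ?\<psi>) q = (s (snd q))\<^sup>2 * coeff_g z l (?\<psi> q)"
    if q: "q \<in> ?V" for q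
    using S(7-9)[OF inD[OF q]] lorentz_commute
    by (simp_all add: coeff_e_def coeff_f_def coeff_g_def zxx[OF q] zxy[OF q] zyy[OF q]
        lorentz_simps power2_eq_square)
  have pos: "r (fst q) > 0" "s (snd q) > 0" if "q \<in> ?V" for q
    using that X(3) Y(3) by auto
  have definite: "coeff_E (z \<circ> ?\<psi>) q * a\<^sup>2 + 2 * coeff_F (z \<circ> ?\<psi>) q * a * b +
      coeff_G (z \<circ> ?\<psi>) q * b\<^sup>2 > 0" if q: "q \<in> ?V" and "(a, b) \<noteq> (0, 0)" for q a b
  proof -
    have "coeff_E (z \<circ> ?\<psi>) q > 0" "coeff_G (z \<circ> ?\<psi>) q > 0"
      using pos[OF q] S(4,5)[OF inD[OF q]] by (simp_all add: E[OF q] G[OF q])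
    then show ?thesis
      using that(2) by (cases "a = 0") (auto simp: F[OF q] intro!: add_pos_nonneg)
  qed
  have "inj (frechet_derivative (z \<circ> ?\<psi>) (at q))" if q: "q \<in> ?V" for q
    using inj_derivative_of_definite[OF smooth_on_has_derivative[OF smooth_psi[OF S(2)] q] definite[OF q]] .
  then have "timelike_surface ?V (z \<circ> ?\<psi>)"
    using V J(2) K(2) smooth_psi[OF S(2)] definite
    by (auto simp: timelike_surface_def intro: connected_Times simp del: o_apply)
  moreover have "unit_normal ?V (z \<circ> ?\<psi>) (l \<circ> ?\<psi>)"
    using smooth_psi[OF S(3)] P S(8-10)[OF inD] by (auto simp: unit_normal_def lorentz_simps)
  moreover have "principal_net ?V (z \<circ> ?\<psi>) (l \<circ> ?\<psi>)"
    using F f by (simp add: principal_net_def)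
  moreover have "nu1 (z \<circ> ?\<psi>) (l \<circ> ?\<psi>) q - nu2 (z \<circ> ?\<psi>) (l \<circ> ?\<psi>) q > 0" if q: "q \<in> ?V" for q
    using S(12)[OF inD[OF q]] pos[OF q]
    by (simp add: nu1_def nu2_def E[OF q] G[OF q] e[OF q] g[OF q])
  moreover have "\<sigma> * det (vector [partial_x (z \<circ> ?\<psi>) q, partial_y (z \<circ> ?\<psi>) q, (l \<circ> ?\<psi>) q] :: real^3^3) > 0"
    if q: "q \<in> ?V" for q
  proof -
    have "det (vector [partial_x (z \<circ> ?\<psi>) q, partial_y (z \<circ> ?\<psi>) q, (l \<circ> ?\<psi>) q] :: real^3^3) =
        r (fst q) * s (snd q) * det (vector [partial_x z (?\<psi> q), partial_y z (?\<psi> q), l (?\<psi> q)] :: real^3^3)"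
      using P[OF q] by (simp add: det_3 algebra_simps)
    then show ?thesis
      using mult_pos_pos[OF mult_pos_pos[OF pos[OF q]] S(11)[OF inD[OF q]]] by (simp add: ac_simps)
  qed
  ultimately show "principal_timelike_surface \<sigma> ?V (z \<circ> ?\<psi>) (l \<circ> ?\<psi>)"
    using surf by (auto simp: principal_timelike_surface_def simp del: o_apply)
  show "q \<in> ?V \<Longrightarrow> coeff_E (z \<circ> ?\<psi>) q = (r (fst q))\<^sup>2 * coeff_E z (?\<psi> q)"
    and "q \<in> ?V \<Longrightarrow> coeff_G (z \<circ> ?\<psi>) q = (s (snd q))\<^sup>2 * coeff_G z (?\<psi> q)"
    by (fact E, fact G)
qed

section \<open>Boxes and slices, and the construction of the new parameters\<close>

lemma open_contains_square:
  fixes D :: "(real \<times> real) set"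
  assumes "open D" and "(x, y) \<in> D"
  obtains \<epsilon> where "\<epsilon> > 0" and "{x-\<epsilon><..<x+\<epsilon>} \<times> {y-\<epsilon><..<y+\<epsilon>} \<subseteq> D"
proof -
  obtain A B where AB: "open A" "open B" "x \<in> A" "y \<in> B" "A \<times> B \<subseteq> D"
    using open_prod_elim[OF assms] by (metis mem_Sigma_iff)
  obtain \<delta> \<eta> where "\<delta> > 0" "ball x \<delta> \<subseteq> A" "\<eta> > 0" "ball y \<eta> \<subseteq> B"
    using AB open_contains_ball by metis
  then have "{x - min \<delta> \<eta><..<x + min \<delta> \<eta>} \<times> {y - min \<delta> \<eta><..<y + min \<delta> \<eta>} \<subseteq> D"
    using AB(5) by (fastforce simp: ball_eq_greaterThanLessThan subset_iff)
  with \<open>\<delta> > 0\<close> \<open>\<eta> > 0\<close> show thesis by (intro that[of "min \<delta> \<eta>"]) auto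
qed

text \<open>Convexity of the two factors makes every slice of the box an interval, on which a zero
  derivative forces a constant.\<close>

lemma constant_in_variable:
  fixes h :: "real \<times> real \<Rightarrow> 'a::euclidean_space"
  assumes h: "smooth_on D h" and I: "convex I" "convex K" "I \<times> K \<subseteq> D"
  shows "(\<And>p. p \<in> D \<Longrightarrow> partial_x h p = 0) \<Longrightarrow> x \<in> I \<Longrightarrow> x' \<in> I \<Longrightarrow> y \<in> K \<Longrightarrow> h (x, y) = h (x', y)"
    and "(\<And>p. p \<in> D \<Longrightarrow> partial_y h p = 0) \<Longrightarrow> x \<in> I \<Longrightarrow> y \<in> K \<Longrightarrow> y' \<in> K \<Longrightarrow> h (x, y) = h (x, y')"
proof -
  have der: "((\<lambda>t. h (t, y)) has_vector_derivative partial_x h (x, y)) (at x within I)"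
    "((\<lambda>t. h (x, t)) has_vector_derivative partial_y h (x, y)) (at y within K)"
    if "x \<in> I" "y \<in> K" for x y
    using smooth_on_has_partials[OF h, of "(x, y)"] I(3) that
    by (auto intro: has_vector_derivative_at_within)
  show "h (x, y) = h (x', y)"
    if "\<And>p. p \<in> D \<Longrightarrow> partial_x h p = 0" "x \<in> I" "x' \<in> I" "y \<in> K"
    using der(1) that I(3) unfolding has_vector_derivative_def
    by (intro has_derivative_zero_unique[OF I(1), of "\<lambda>t. h (t, y)"]) (auto simp: subset_iff)
  show "h (x, y) = h (x, y')"
    if "\<And>p. p \<in> D \<Longrightarrow> partial_y h p = 0" "x \<in> I" "y \<in> K" "y' \<in> K"
    using der(2) that I(3) unfolding has_vector_derivative_def
    by (intro has_derivative_zero_unique[OF I(2), of "\<lambda>t. h (x, t)"]) (auto simp: subset_iff)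
qed

lemma diffeomorphism_map_prod:
  assumes "diffeomorphism I J X X'" and "diffeomorphism L K Y Y'"
  shows "diffeomorphism (I \<times> L) (J \<times> K) (map_prod X Y) (map_prod X' Y')"
proof -
  have X: "open I" "open J" "homeomorphism I J X X'" "smooth_on I X" "smooth_on J X'"
    and Y: "open L" "open K" "homeomorphism L K Y Y'" "smooth_on L Y" "smooth_on K Y'"
    using assms by (auto simp: diffeomorphism_def)
  have sm: "smooth_on (I \<times> L) (map_prod X Y)" "smooth_on (J \<times> K) (map_prod X' Y')"
    using X Y by (auto intro: smooth_on_map_prod)
  then have "continuous_on (I \<times> L) (map_prod X Y)" "continuous_on (J \<times> K) (map_prod X' Y')"
    unfolding smooth_on_def by (metis Ck_on.simps(1))+
  then have "homeomorphism (I \<times> L) (J \<times> K) (map_prod X Y) (map_prod X' Y')"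
    using X(3) Y(3) by (intro homeomorphismI) (auto simp: homeomorphism_def)
  then show ?thesis using X Y sm by (auto simp: diffeomorphism_def open_Times)
qed

lemma smooth_on_sqrt:
  assumes "open S" and "smooth_on S f" and "\<And>x. x \<in> S \<Longrightarrow> f x > 0"
  shows "smooth_on S (\<lambda>x. sqrt (f x))"
proof -
  have "smooth_on S (sqrt \<circ> f)"
    using assms by (intro smooth_on_compose[where T = "{0<..}"]) (auto simp: smooth_on_def intro: Ck_on_sqrt)
  then show ?thesis by (simp add: o_def)
qed

lemma smooth_on_slices:
  assumes "open D" and "smooth_on D h" and "open S"
  shows "(\<And>t. t \<in> S \<Longrightarrow> (t, b) \<in> D) \<Longrightarrow> smooth_on S (\<lambda>t. h (t, b))"
    and "(\<And>t. t \<in> S \<Longrightarrow> (a, t) \<in> D) \<Longrightarrow> smooth_on S (\<lambda>t. h (a, t))"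
proof -
  have "smooth_on S (\<lambda>t. (t, b))" "smooth_on S (\<lambda>t. (a, t))"
    unfolding smooth_on_def
    by (simp_all add: Ck_on_Pair Ck_on_const bounded_linear_Ck_on[OF bounded_linear_ident] \<open>open S\<close>)
  then show "(\<And>t. t \<in> S \<Longrightarrow> (t, b) \<in> D) \<Longrightarrow> smooth_on S (\<lambda>t. h (t, b))"
    and "(\<And>t. t \<in> S \<Longrightarrow> (a, t) \<in> D) \<Longrightarrow> smooth_on S (\<lambda>t. h (a, t))"
    using smooth_on_compose[OF assms(3,1) _ _ assms(2), of "\<lambda>t. (t, b)"]
      smooth_on_compose[OF assms(3,1) _ _ assms(2), of "\<lambda>t. (a, t)"]
    by (auto simp: o_def image_subset_iff)
qed

theorem proposition2p2:
  fixes D :: "(real \<times> real) set" and z l :: "real \<times> real \<Rightarrow> real^3" and \<sigma> :: real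
  assumes "principal_timelike_surface \<sigma> D z l"
    and "strongly_regular D z"
    and "minimal_surface D z l"
  shows "\<forall>p\<in>D. \<exists>U V \<phi> \<psi>.
           p \<in> U \<and> U \<subseteq> D \<and> diffeomorphism U V \<phi> \<psi> \<and>
           principal_timelike_surface \<sigma> V (z \<circ> \<psi>) (l \<circ> \<psi>) \<and>
           (\<forall>q\<in>V. coeff_E (z \<circ> \<psi>) q = 1 / nu1 z l (\<psi> q) \<and>
                   coeff_G (z \<circ> \<psi>) q = 1 / nu1 z l (\<psi> q))"
proof
  fix p assume "p \<in> D"
  obtain x0 y0 where p: "p = (x0, y0)" by (cases p)
  note S = principal_timelike_surfaceD[OF assms(1)]
  have min: "nu2 z l q = - nu1 z l q" if "q \<in> D" for q
    using assms(3) that by (auto simp: minimal_surface_def eq_neg_iff_add_eq_0 add.commute)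
  \<comment> \<open>With \<open>nu2 = - nu1\<close> the standing convention
    \<open>nu1 - nu2 > 0\<close> reads \<open>2 * nu1 > 0\<close>.\<close>
  have nu: "nu1 z l q > 0" if "q \<in> D" for q
    using S(12)[OF that] min[OF that] by simp
  have e: "coeff_e z l q = nu1 z l q * coeff_E z q" and g: "- coeff_g z l q = nu1 z l q * coeff_G z q"
    if "q \<in> D" for q
  proof -
    show "coeff_e z l q = nu1 z l q * coeff_E z q"
      using S(4)[OF that] by (simp add: nu1_def)
    have "coeff_g z l q = nu2 z l q * coeff_G z q"
      using S(5)[OF that] by (simp add: nu2_def)
    then show "- coeff_g z l q = nu1 z l q * coeff_G z q"
      by (simp add: min[OF that])
  qed
  have e_pos: "coeff_e z l q > 0" and g_neg: "- coeff_g z l q > 0" if "q \<in> D" for q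
    unfolding e[OF that] g[OF that] using S(4,5)[OF that] nu[OF that] by simp_all
  have e_smooth: "smooth_on D (coeff_e z l)" and g_smooth: "smooth_on D (coeff_g z l)"
    unfolding coeff_e_def[abs_def] coeff_g_def[abs_def]
    by (intro smooth_on_bounded_bilinear[OF bounded_bilinear_lorentz] smooth_on_partials S(1-3))+
  have e_y: "partial_y (coeff_e z l) q = 0" and g_x: "partial_x (coeff_g z l) q = 0"
    if "q \<in> D" for q
    using Codazzi_principal[OF assms(1) that] min[OF that] by simp_all
  obtain \<epsilon> where "\<epsilon> > 0" and box: "{x0-\<epsilon><..<x0+\<epsilon>} \<times> {y0-\<epsilon><..<y0+\<epsilon>} \<subseteq> D"
    using open_contains_square S(1) \<open>p \<in> D\<close> p by blast
  let ?A = "{x0-\<epsilon><..<x0+\<epsilon>}" and ?B = "{y0-\<epsilon><..<y0+\<epsilon>}"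
  have x0: "x0 \<in> ?A" and y0: "y0 \<in> ?B" using \<open>\<epsilon> > 0\<close> by auto
  \<comment> \<open>The speeds are read off on the two axes of the box through \<open>p\<close>, as
    functions of one variable each.\<close>
  define a where "a = (\<lambda>x. sqrt (coeff_e z l (x, y0)))"
  define b where "b = (\<lambda>y. sqrt (- coeff_g z l (x0, y)))"
  have xD: "(x, y0) \<in> D" if "x \<in> ?A" for x using box that y0 by blast
  have yD: "(x0, y) \<in> D" if "y \<in> ?B" for y using box that x0 by blast
  have a_pos: "a x > 0" if "x \<in> ?A" for x using e_pos[OF xD[OF that]] by (simp add: a_def)
  have b_pos: "b y > 0" if "y \<in> ?B" for y using g_neg[OF yD[OF that]] by (simp add: b_def)
  have "smooth_on D (\<lambda>q. - coeff_g z l q)"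
    using g_smooth S(1) Ck_on_bounded_linear[OF bounded_linear_minus[OF bounded_linear_ident]]
    unfolding smooth_on_def by blast
  then have "smooth_on ?B (\<lambda>y. - coeff_g z l (x0, y))"
    using smooth_on_slices(2)[OF S(1) _ open_greaterThanLessThan, where h = "\<lambda>q. - coeff_g z l q"] yD
    by blast
  then have b: "smooth_on ?B b"
    unfolding b_def using g_neg yD by (intro smooth_on_sqrt) auto
  have "smooth_on ?A (\<lambda>x. coeff_e z l (x, y0))"
    using smooth_on_slices(1)[OF S(1) e_smooth open_greaterThanLessThan] xD by blast
  then have a: "smooth_on ?A a"
    unfolding a_def using e_pos xD by (intro smooth_on_sqrt) auto
  \<comment> \<open>The Codazzi equations enter here: inside the box, \<open>e\<close> is carried
    along vertical segments and \<open>g\<close> along horizontal ones to the axes on which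
    \<open>a\<close> and \<open>b\<close> were defined.\<close>
  have a2: "(a x)\<^sup>2 = coeff_e z l (x, y)" and b2: "(b y)\<^sup>2 = - coeff_g z l (x, y)"
    if "x \<in> ?A" "y \<in> ?B" for x y
  proof -
    have "coeff_e z l (x, y) = coeff_e z l (x, y0)"
      by (rule constant_in_variable(2)[OF e_smooth _ _ box]) (use e_y that y0 in auto)
    moreover have "coeff_e z l (x, y0) > 0" using e_pos box that y0 by blast
    ultimately show "(a x)\<^sup>2 = coeff_e z l (x, y)" by (simp add: a_def)
    have "coeff_g z l (x, y) = coeff_g z l (x0, y)"
      by (rule constant_in_variable(1)[OF g_smooth _ _ box]) (use g_x that x0 in auto)
    moreover have "- coeff_g z l (x0, y) > 0" using g_neg box that x0 by blast
    ultimately show "(b y)\<^sup>2 = - coeff_g z l (x, y)" by (simp add: b_def)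
  qed
  \<comment> \<open>Half the box, so that the closed intervals still lie in the open ones where
    \<open>a\<close> and \<open>b\<close> are smooth and positive.\<close>
  let ?I = "{x0-\<epsilon>/2<..<x0+\<epsilon>/2}" and ?L = "{y0-\<epsilon>/2<..<y0+\<epsilon>/2}"
  have sub: "?I \<subseteq> ?A" "?L \<subseteq> ?B" using \<open>\<epsilon> > 0\<close> by auto
  obtain X X' \<alpha> \<beta> where X: "diffeomorphism ?I {\<alpha><..<\<beta>} X X'"
    "smooth_on {\<alpha><..<\<beta>} (\<lambda>u. inverse (a (X' u)))"
    "\<And>u. u \<in> {\<alpha><..<\<beta>} \<Longrightarrow> (X' has_real_derivative inverse (a (X' u))) (at u)"
  proof (rule smooth_reparametrization[OF _ _ _ a a_pos])
    show "{x0-\<epsilon>/2..x0+\<epsilon>/2} \<subseteq> ?A" "x0-\<epsilon>/2 < x0+\<epsilon>/2" using \<open>\<epsilon> > 0\<close> by auto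
  qed auto
  obtain Y Y' \<gamma> \<delta> where Y: "diffeomorphism ?L {\<gamma><..<\<delta>} Y Y'"
    "smooth_on {\<gamma><..<\<delta>} (\<lambda>v. inverse (b (Y' v)))"
    "\<And>v. v \<in> {\<gamma><..<\<delta>} \<Longrightarrow> (Y' has_real_derivative inverse (b (Y' v))) (at v)"
  proof (rule smooth_reparametrization[OF _ _ _ b b_pos])
    show "{y0-\<epsilon>/2..y0+\<epsilon>/2} \<subseteq> ?B" "y0-\<epsilon>/2 < y0+\<epsilon>/2" using \<open>\<epsilon> > 0\<close> by auto
  qed auto
  let ?J = "{\<alpha><..<\<beta>}" and ?K = "{\<gamma><..<\<delta>}" and ?\<psi> = "map_prod X' Y'"
  have XA: "X' u \<in> ?A" if "u \<in> ?J" for u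
    using X(1) sub(1) that unfolding diffeomorphism_def homeomorphism_def by blast
  have YB: "Y' v \<in> ?B" if "v \<in> ?K" for v
    using Y(1) sub(2) that unfolding diffeomorphism_def homeomorphism_def by blast
  have img: "?\<psi> ` (?J \<times> ?K) \<subseteq> D"
    using XA YB box by (auto simp: subset_iff)
  have smooth: "smooth_on ?J X'" "smooth_on ?K Y'"
    using X(1) Y(1) by (simp_all add: diffeomorphism_def)
  have a_inv: "inverse (a (X' u)) > 0" if "u \<in> ?J" for u
    using a_pos[OF XA[OF that]] by simp
  have b_inv: "inverse (b (Y' v)) > 0" if "v \<in> ?K" for v
    using b_pos[OF YB[OF that]] by simp
  \<comment> \<open>The old parameters are functions of the new ones here, so their speeds are the
    reciprocals of \<open>a\<close> and \<open>b\<close>.\<close>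
  note reparam = principal_reparametrization[OF assms(1) open_greaterThanLessThan connected_Ioo
      open_greaterThanLessThan connected_Ioo smooth(1) X(2) a_inv X(3) smooth(2) Y(2) b_inv Y(3)
      img]
  have surf: "principal_timelike_surface \<sigma> (?J \<times> ?K) (z \<circ> ?\<psi>) (l \<circ> ?\<psi>)"
    by (rule reparam)
  have E: "coeff_E (z \<circ> ?\<psi>) q = (inverse (a (X' (fst q))))\<^sup>2 * coeff_E z (?\<psi> q)"
    and G: "coeff_G (z \<circ> ?\<psi>) q = (inverse (b (Y' (snd q))))\<^sup>2 * coeff_G z (?\<psi> q)"
    if "q \<in> ?J \<times> ?K" for q
    using reparam(2,3)[where q = q] that by blast+
  have "coeff_E (z \<circ> ?\<psi>) q = 1 / nu1 z l (?\<psi> q) \<and> coeff_G (z \<circ> ?\<psi>) q = 1 / nu1 z l (?\<psi> q)"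
    if q: "q \<in> ?J \<times> ?K" for q
  proof -
    have D: "?\<psi> q \<in> D" using img q by blast
    have xy: "X' (fst q) \<in> ?A" "Y' (snd q) \<in> ?B" using XA YB q by auto
    \<comment> \<open>The squared speeds are \<open>\<nu>E\<close> and \<open>\<nu>G\<close>;
      dividing \<open>E\<close> and \<open>G\<close> by them leaves \<open>1/\<nu>\<close> in both
      cases.\<close>
    have "(a (X' (fst q)))\<^sup>2 = nu1 z l (?\<psi> q) * coeff_E z (?\<psi> q)"
      and "(b (Y' (snd q)))\<^sup>2 = nu1 z l (?\<psi> q) * coeff_G z (?\<psi> q)"
      using a2[OF xy] b2[OF xy] e[OF D] g[OF D] by (simp_all add: map_prod_def split_beta)
    then show ?thesis
      unfolding E[OF q] G[OF q] power_inverse using S(4,5)[OF D]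
      by (simp add: mult.assoc divide_inverse)
  qed
  moreover have "p \<in> ?I \<times> ?L" using \<open>\<epsilon> > 0\<close> p by simp
  moreover have "?I \<times> ?L \<subseteq> D" using sub box by blast
  ultimately show "\<exists>U V \<phi> \<psi>. p \<in> U \<and> U \<subseteq> D \<and> diffeomorphism U V \<phi> \<psi> \<and>
      principal_timelike_surface \<sigma> V (z \<circ> \<psi>) (l \<circ> \<psi>) \<and>
      (\<forall>q\<in>V. coeff_E (z \<circ> \<psi>) q = 1 / nu1 z l (\<psi> q) \<and> coeff_G (z \<circ> \<psi>) q = 1 / nu1 z l (\<psi> q))"
    using diffeomorphism_map_prod[OF X(1) Y(1)] surf
    by (intro exI[of _ "?I \<times> ?L"] exI[of _ "?J \<times> ?K"] exI[of _ "map_prod X Y"] exI[of _ ?\<psi>]) simp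
qed

end
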